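(* If $G$ is a simple connected $n$-vertex graph such that $\operatorname{edim}(G) = n-2$, then $G$ has diameter at most $5$.
   Context: All graphs are simple and connected. For vertices $u,v$ of a graph $G$, $d(u,v)$ is their distance in $G$; the diameter is the maximum distance between two vertices. For an edge $e=\{x,y\}$ and a vertex $v$, let $d(e,v)=\min(d(x,v),d(y,v))$. A set $S\subset V(G)$ is a resolving set for the edges of $G$ if no two distinct edges $e,f$ satisfy $d(e,s)=d(f,s)$ for all $s\in S$. The edge metric dimension $\operatorname{edim}(G)$ is the minimum size of a resolving set for the edges of $G$. *)

theory Defs
  imports "Graph_Theory.Graph_Theory"
begin

text \<open>
  A finite simple graph is, as in \<^theory>\<open>Graph_Theory.Digraph\<close>, a finite symmetric digraph
  without loops and parallel arcs (locale \<^locale>\<open>graph\<close>). An undirected edge corresponds to two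
  opposite arcs, so the edge set consists of the unordered pairs of endpoints.
\<close>

definition edges :: "('a, 'b) pre_digraph \<Rightarrow> 'a set set" where
  "edges G = {{x, y} | x y. (x, y) \<in> arcs_ends G}"

text \<open>
  Distances are shortest-path costs for unit weights. They are extended reals (infinite between
  vertices in different components); in a connected graph they are natural numbers.
\<close>

definition gdist :: "('a, 'b) pre_digraph \<Rightarrow> 'a \<Rightarrow> 'a \<Rightarrow> ereal" where
  "gdist G u v = wf_digraph.\<mu> G (\<lambda>_. 1) u v"

definition gdiam :: "('a, 'b) pre_digraph \<Rightarrow> ereal" where
  "gdiam G = Max {gdist G u v | u v. u \<in> verts G \<and> v \<in> verts G}"

definition edge_dist :: "('a, 'b) pre_digraph \<Rightarrow> 'a set \<Rightarrow> 'a \<Rightarrow> ereal" where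
  "edge_dist G e v = Min ((\<lambda>x. gdist G x v) ` e)"

definition edge_resolving :: "('a, 'b) pre_digraph \<Rightarrow> 'a set \<Rightarrow> bool" where
  "edge_resolving G S \<longleftrightarrow> S \<subseteq> verts G \<and>
     \<not> (\<exists>e\<in>edges G. \<exists>f\<in>edges G. e \<noteq> f \<and> (\<forall>s\<in>S. edge_dist G e s = edge_dist G f s))"

text \<open>
  For a finite simple graph the minimum exists, since the set of all vertices resolves the edges.
\<close>

definition edim :: "('a, 'b) pre_digraph \<Rightarrow> nat" where
  "edim G = (LEAST k. \<exists>S. edge_resolving G S \<and> card S = k)"

end

theory Submission
  imports Defs
begin

text \<open>
  Deleting from the vertex set a set \<open>R\<close> of vertices at pairwise distance at least three leaves a
  resolving set for the edges. Indeed, a vertex lies on an edge exactly when its distance to the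
  edge is zero, so two edges that are not resolved by the remaining vertices agree outside \<open>R\<close>.
  No edge joins two vertices of \<open>R\<close>, so both edges have an endpoint \<open>s\<close> outside \<open>R\<close>, and they have
  it in common. If they differ, their other endpoints are two vertices of \<open>R\<close>, and these are at
  distance at most two through \<open>s\<close>, which is impossible.
  Consequently \<open>edim G \<le> n - card R\<close> (\<open>edim_packing_le\<close>).

  If the diameter exceeds five, choose vertices \<open>u\<close> and \<open>v\<close> at distance at least six. Any walk from
  \<open>u\<close> to \<open>v\<close> contains a vertex \<open>w\<close> at distance three from \<open>u\<close>, and \<open>w\<close> is at distance at least
  three from \<open>v\<close> by the triangle inequality. The set \<open>{u, w, v}\<close> then gives \<open>edim G \<le> n - 3\<close>.
\<close>

section \<open>The metric of a graph\<close>

lemma (in wf_digraph) gdist_le_length: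
  assumes "awalk u p v"
  shows "gdist G u v \<le> length p"
proof -
  have "awalk_cost (\<lambda>_. 1) p = length p"
    by (simp add: awalk_cost_def sum_list_triv)
  then show ?thesis
    using min_cost_le_walk_cost[OF assms, of "\<lambda>_. 1"] by (simp add: gdist_def)
qed

text \<open>Distances are attained, which turns the algebra of walks into the axioms of a metric.\<close>

lemma (in fin_digraph) shortest_awalk:
  assumes "gdist G u v \<noteq> \<infinity>"
  obtains p where "awalk u p v" "gdist G u v = length p"
proof -
  have "u \<rightarrow>\<^sup>* v"
    using assms \<mu>_reach_conv[of "\<lambda>_. 1" u v] by (simp add: gdist_def)
  then obtain p where p: "apath u p v" "\<mu> (\<lambda>_. 1) u v = awalk_cost (\<lambda>_. 1) p"
    using min_cost_awalk[of u v "\<lambda>_. 1"] by auto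
  have "awalk_cost (\<lambda>_. 1) p = length p"
    by (simp add: awalk_cost_def sum_list_triv)
  with p show ?thesis
    by (intro that[of p]) (auto simp: gdist_def apath_def)
qed

lemma (in fin_digraph) gdist_nonneg: "0 \<le> gdist G u v"
  by (cases "gdist G u v = \<infinity>") (auto elim: shortest_awalk)

lemma (in fin_digraph) gdist_self: "u \<in> verts G \<Longrightarrow> gdist G u u = 0"
  using gdist_le_length[of u "[]" u] gdist_nonneg[of u u] by (simp add: awalk_Nil_iff zero_ereal_def)

lemma (in fin_digraph) gdist_pos:
  assumes "u \<noteq> v"
  shows "0 < gdist G u v"
proof (cases "gdist G u v = \<infinity>")
  case False
  then obtain p where p: "awalk u p v" "gdist G u v = length p"
    by (rule shortest_awalk)
  moreover from p(1) assms have "p \<noteq> []"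
    by (auto simp: awalk_Nil_iff)
  ultimately show ?thesis by simp
qed simp

lemma (in fin_digraph) gdist_triangle: "gdist G u v \<le> gdist G u w + gdist G w v"
proof (cases "gdist G u w = \<infinity> \<or> gdist G w v = \<infinity>")
  case False
  then obtain p q where p: "awalk u p w" "gdist G u w = length p"
    and q: "awalk w q v" "gdist G w v = length q"
    by (meson shortest_awalk)
  from p(1) q(1) have "awalk u (p @ q) v" by (rule awalk_appendI)
  from gdist_le_length[OF this] p q show ?thesis by simp
qed (use gdist_nonneg in auto)

lemma (in fin_digraph) gdist_adj:
  assumes "u \<rightarrow> v"
  shows "gdist G u v \<le> 1"
proof -
  obtain e where "e \<in> arcs G" "tail G e = u" "head G e = v"
    using assms by (rule reachableE)
  then have "awalk u [e] v" by (auto simp: awalk_simps)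
  from gdist_le_length[OF this] show ?thesis by (simp add: one_ereal_def)
qed

text \<open>
  Every arc has an opposite one, so a walk can be traversed backwards, though along different arcs.
\<close>

lemma (in sym_digraph) awalk_reverse:
  "awalk u p v \<Longrightarrow> \<exists>q. awalk v q u \<and> length q = length p"
proof (induction p arbitrary: u)
  case (Cons e p)
  then obtain q where q: "awalk v q (head G e)" "length q = length p"
    by (auto simp: awalk_Cons_iff)
  have "e \<in> arcs G" and tail: "tail G e = u"
    using Cons.prems by (auto simp: awalk_Cons_iff)
  then obtain e' where "e' \<in> arcs G" "tail G e' = head G e" "head G e' = u"
    using sym_arcs unfolding symmetric_conv by metis
  then have "awalk (head G e) [e'] u" by (auto simp: awalk_simps)
  with q have "awalk v (q @ [e']) u" by (blast intro: awalk_appendI)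
  with q(2) show ?case by (intro exI[of _ "q @ [e']"]) simp
qed (auto simp: awalk_Nil_iff)

lemma (in pseudo_graph) gdist_commute: "gdist G u v = gdist G v u"
proof -
  have "gdist G y x \<le> gdist G x y" for x y
  proof (cases "gdist G x y = \<infinity>")
    case False
    then obtain p where "awalk x p y" "gdist G x y = length p"
      by (rule shortest_awalk)
    then show ?thesis by (metis awalk_reverse gdist_le_length)
  qed simp
  then show ?thesis by (simp add: antisym)
qed

text \<open>
  A discrete intermediate value theorem: a step along an arc increases the distance from \<open>u\<close> by at
  most one, so on a walk from \<open>u\<close> to \<open>v\<close> the first vertex further than \<open>r\<close> from \<open>u\<close> qualifies.
\<close>

lemma (in fin_digraph) ex_vertex_just_beyond:
  assumes "u \<rightarrow>\<^sup>* v" "0 \<le> r" "r < gdist G u v"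
  shows "\<exists>w\<in>verts G. r < gdist G u w \<and> gdist G u w \<le> r + 1"
  using assms(1,3)
proof (induction rule: reachable_induct)
  case base
  then show ?case using gdist_self[of u] assms(2) by auto
next
  case (step x y)
  show ?case
  proof (cases "r < gdist G u x")
    case False
    have "gdist G u y \<le> gdist G u x + gdist G x y" by (rule gdist_triangle)
    also have "\<dots> \<le> r + 1"
      using False gdist_adj[OF step.hyps(2)] by (intro add_mono) auto
    finally show ?thesis
      using step.prems adj_in_verts(2)[OF step.hyps(2)] by blast
  qed (use step.IH in blast)
qed

section \<open>Resolving edges by the complement of a packing\<close>

lemma (in fin_digraph) edgeE:
  assumes "e \<in> edges G"
  obtains x y where "e = {x, y}" "x \<rightarrow> y" "x \<in> verts G" "y \<in> verts G"
  using assms adj_in_verts by (auto simp: edges_def)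

lemma (in fin_digraph) edge_dist_eq_0_iff:
  assumes "e \<in> edges G"
  shows "edge_dist G e s = 0 \<longleftrightarrow> s \<in> e"
proof -
  obtain x y where e: "e = {x, y}" and v: "x \<in> verts G" "y \<in> verts G"
    using assms by (rule edgeE)
  have zero: "gdist G z s = 0 \<longleftrightarrow> z = s" if "z \<in> verts G" for z
    using gdist_pos[of z s] gdist_self[OF that] by (metis less_irrefl)
  have "edge_dist G e s = 0 \<longleftrightarrow> gdist G x s = 0 \<or> gdist G y s = 0"
    using gdist_nonneg[of x s] gdist_nonneg[of y s]
    by (auto simp: edge_dist_def e min_def)
  then show ?thesis using zero v by (auto simp: e)
qed

text \<open>
  Every edge leaves \<open>R\<close> and every vertex has at most one neighbour in \<open>R\<close>, so an edge is determined
  by its endpoints outside \<open>R\<close>. These are exactly the vertices outside \<open>R\<close> at distance zero from it.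
\<close>

lemma (in pseudo_graph) edge_resolving_Diff_packing:
  assumes packing: "\<And>a b. a \<in> R \<Longrightarrow> b \<in> R \<Longrightarrow> a \<noteq> b \<Longrightarrow> 2 < gdist G a b"
    and loopfree: "\<And>a. \<not> a \<rightarrow> a"
  shows "edge_resolving G (verts G - R)"
proof -
  have not_adj: "\<not> a \<rightarrow> b" if "a \<in> R" "b \<in> R" for a b
  proof
    assume adj: "a \<rightarrow> b"
    then have "2 < gdist G a b" using packing that loopfree by metis
    also have "\<dots> \<le> 1" using adj by (rule gdist_adj)
    finally show False by simp
  qed
  have unique_nbr: "a = b" if "s \<rightarrow> a" "s \<rightarrow> b" "a \<in> R" "b \<in> R" for s a b
  proof (rule ccontr)
    assume "a \<noteq> b"
    then have "2 < gdist G a b" using packing that by blast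
    also have "\<dots> \<le> gdist G a s + gdist G s b" by (rule gdist_triangle)
    also have "\<dots> \<le> 1 + 1"
      using gdist_adj[OF that(1)] gdist_adj[OF that(2)]
      by (intro add_mono) (simp_all add: gdist_commute[of a s])
    finally show False by simp
  qed
  have ends: "\<exists>s z. e = {s, z} \<and> s \<rightarrow> z \<and> s \<in> verts G - R" if e: "e \<in> edges G" for e
  proof -
    obtain x y where xy: "e = {x, y}" "x \<rightarrow> y" "x \<in> verts G" "y \<in> verts G"
      using e by (rule edgeE)
    then have "y \<rightarrow> x" using sym_arcs by (blast intro: arcs_ends_symmetric)
    have "x \<notin> R \<or> y \<notin> R" using not_adj xy(2) by blast
    then show ?thesis
    proof
      assume "x \<notin> R"
      with xy show ?thesis by blast
    next
      assume "y \<notin> R"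
      with xy \<open>y \<rightarrow> x\<close> show ?thesis by (intro exI[of _ y] exI[of _ x]) auto
    qed
  qed
  have "e = f"
    if e: "e \<in> edges G" and f: "f \<in> edges G"
      and unresolved: "\<forall>s\<in>verts G - R. edge_dist G e s = edge_dist G f s" for e f
  proof -
    have trace: "s \<in> e \<longleftrightarrow> s \<in> f" if "s \<in> verts G - R" for s
      using unresolved that edge_dist_eq_0_iff[OF e] edge_dist_eq_0_iff[OF f] by metis
    obtain s a where e_eq: "e = {s, a}" and sa: "s \<rightarrow> a" and s: "s \<in> verts G - R"
      using ends[OF e] by blast
    have "s \<in> f" using trace[OF s] e_eq by blast
    then obtain b where f_eq: "f = {s, b}" and sb: "s \<rightarrow> b"
      using f arcs_ends_symmetric[OF sym_arcs] by (auto simp: edges_def insert_commute)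
    have "a \<noteq> s" "b \<noteq> s" using sa sb loopfree by auto
    then have "a = b"
      using trace[of a] trace[of b] unique_nbr[OF sa sb]
        adj_in_verts(2)[OF sa] adj_in_verts(2)[OF sb]
      by (auto simp: e_eq f_eq)
    then show ?thesis by (simp add: e_eq f_eq)
  qed
  then show ?thesis by (auto simp: edge_resolving_def)
qed

lemma (in graph) edim_packing_le:
  assumes "R \<subseteq> verts G"
    and "\<And>a b. a \<in> R \<Longrightarrow> b \<in> R \<Longrightarrow> a \<noteq> b \<Longrightarrow> 2 < gdist G a b"
  shows "edim G \<le> card (verts G) - card R"
proof -
  have "edge_resolving G (verts G - R)"
    using assms(2) adj_not_same by (intro edge_resolving_Diff_packing) blast+
  moreover have "card (verts G - R) = card (verts G) - card R"
    using assms(1) finite_subset[OF assms(1)] by (intro card_Diff_subset) auto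
  ultimately show ?thesis
    unfolding edim_def by (intro Least_le) blast
qed

section \<open>Large diameter\<close>

text \<open>
  The lower bound for the distance from \<open>w\<close> to \<open>v\<close> is the triangle inequality, with \<open>w\<close> at distance
  at most three from \<open>u\<close>.
\<close>

lemma (in graph) edim_le_if_far_apart:
  assumes "u \<rightarrow>\<^sup>* v" "5 < gdist G u v"
  shows "3 \<le> card (verts G) \<and> edim G \<le> card (verts G) - 3"
proof -
  have uv: "u \<in> verts G" "v \<in> verts G"
    using assms(1) by (auto dest: reachable_in_verts)
  have far_uv: "2 < gdist G u v"
    by (rule less_trans[OF _ assms(2)]) simp
  then obtain w where w: "w \<in> verts G" "2 < gdist G u w" "gdist G u w \<le> 2 + 1"
    using ex_vertex_just_beyond[OF assms(1), of 2] by auto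
  have far_wv: "2 < gdist G w v"
  proof (rule ccontr)
    assume "\<not> 2 < gdist G w v"
    then have "gdist G u w + gdist G w v \<le> (2 + 1) + 2"
      using w(3) by (intro add_mono) auto
    with gdist_triangle[of u v w] have "gdist G u v \<le> 5" by (auto intro: order_trans)
    with assms(2) show False by simp
  qed
  have near: "gdist G x x \<le> 2" if "x \<in> verts G" for x
    using gdist_self[OF that] by simp
  have "u \<noteq> w" "w \<noteq> v" "u \<noteq> v"
    using near[of u] near[of w] uv w(1,2) far_wv far_uv by auto
  then have card: "card {u, w, v} = 3" by auto
  have sub: "{u, w, v} \<subseteq> verts G" using uv w(1) by simp
  have "edim G \<le> card (verts G) - card {u, w, v}"
    using w(2) far_wv far_uv gdist_commute sub by (intro edim_packing_le) auto
  moreover have "card {u, w, v} \<le> card (verts G)"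
    using sub by (intro card_mono) auto
  ultimately show ?thesis by (simp only: card)
qed

theorem theorem4p4:
  fixes G :: "('a, 'b) pre_digraph" and n :: nat
  assumes "graph G"
    and "Digraph_Component.connected G"
    and "card (verts G) = n"
    and "int (edim G) = int n - 2"
  shows "gdiam G \<le> 5"
proof -
  interpret graph G by fact
  have "verts G \<noteq> {}"
    using assms(2) by (simp add: Digraph_Component.connected_def strongly_connected_def)
  moreover have "gdist G u v \<le> 5" if "u \<in> verts G" "v \<in> verts G" for u v
  proof (rule ccontr)
    assume "\<not> gdist G u v \<le> 5"
    moreover have "u \<rightarrow>\<^sup>*\<^bsub>G\<^esub> v"
      using assms(2) that reachable_mk_symmetric_eq[OF sym_arcs]
      by (simp add: Digraph_Component.connected_def strongly_connected_def)
    ultimately have "3 \<le> n \<and> edim G \<le> n - 3"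
      using edim_le_if_far_apart assms(3) by auto
    with assms(4) show False by linarith
  qed
  moreover have "{gdist G u v | u v. u \<in> verts G \<and> v \<in> verts G}
      = (\<lambda>(u, v). gdist G u v) ` (verts G \<times> verts G)"
    by auto
  ultimately show ?thesis by (auto simp: gdiam_def)
qed

end
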